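(* Let $\Delta$ be the triangle graph with bond dimensions $\mathbf m=(m_{01},m_{12},m_{02})=(2,m_{12},2)$ and physical dimensions $\mathbf n=(2,n_1,n_2)$, and let $V_0=\mathbb C^2$, $V_1=\mathbb C^{n_1}$, $V_2=\mathbb C^{n_2}$. Then $$\mathcal{TNS}^\Delta_{\mathbf m,\mathbf n}=\overline{\left\{T\in V_0\otimes V_1\otimes V_2:\ \mathbb P\big(\mathrm{im}(T:V_0^*\to V_1\otimes V_2)\big)\text{ is a line intersecting }\sigma^{n_1\times n_2}_{m_{12}}\text{ in at least two points}\right\}}.$$
   Context: Everything is over $\mathbb C$; all bond and physical dimensions are positive integers; the overline denotes Zariski (equivalently Euclidean) closure. Given bond dimensions $\mathbf m=(m_{01},m_{12},m_{02})$, let $(e_a)_{a\le m_{01}}$, $(f_b)_{b\le m_{12}}$, $(g_c)_{c\le m_{02}}$ be the standard bases of $\mathbb C^{m_{01}},\mathbb C^{m_{12}},\mathbb C^{m_{02}}$, and let $W_0=\mathbb C^{m_{01}}\otimes\mathbb C^{m_{02}}$, $W_1=\mathbb C^{m_{01}}\otimes\mathbb C^{m_{12}}$, $W_2=\mathbb C^{m_{12}}\otimes\mathbb C^{m_{02}}$. The graph tensor is $$T(\Delta,\mathbf m)=\sum_{a,b,c}(e_a\otimes g_c)\otimes(e_a\otimes f_b)\otimes(f_b\otimes g_c)\in W_0\otimes W_1\otimes W_2.$$ For physical dimensions $\mathbf n=(n_0,n_1,n_2)$ and $V_i=\mathbb C^{n_i}$, $\mathcal{TNS}^\Delta_{\mathbf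 m,\mathbf n}\subseteq V_0\otimes V_1\otimes V_2$ is the closure of the set of all $(X_0\otimes X_1\otimes X_2)(T(\Delta,\mathbf m))$ with $X_i\in\mathrm{Hom}(W_i,V_i)$. A tensor $T\in V_0\otimes V_1\otimes V_2$ defines by contraction the flattening map $T:V_0^*\to V_1\otimes V_2$. Elements of $V_1\otimes V_2$ are identified with $n_1\times n_2$ matrices, and $\sigma^{n_1\times n_2}_r\subseteq\mathbb P(\mathbb C^{n_1}\otimes\mathbb C^{n_2})$ is the variety of (classes of nonzero) matrices of rank at most $r$. "Line" means a projective line $\mathbb P^1$, i.e. the image is 2-dimensional.
   Formalization: The case n_1 = n_2 = 1 is excluded (n_1 n_2 ≥ 2 is assumed): there V_1⊗V_2 is one-dimensional, so no image is a line and the right-hand side is empty, while the tensor network variety contains 0. *)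

theory Defs
  imports "HOL-Analysis.Analysis"
begin

text \<open>
  A tensor in \<open>\<complex>\<^sup>x \<otimes> \<complex>\<^sup>y \<otimes> \<complex>\<^sup>z\<close> is an element of \<open>complex^'z^'y^'x\<close> (entry \<open>T $ i $ j $ k\<close>), and
  an element of \<open>\<complex>\<^sup>y \<otimes> \<complex>\<^sup>z\<close> regarded as a matrix is an element of \<open>complex^'z^'y\<close>.
  The factors \<open>W\<^sub>0, W\<^sub>1, W\<^sub>2\<close> of the graph tensor are, as vector spaces, indexed by pairs.
  Closures are taken in the Euclidean topology of \<open>complex^'z^'y^'x\<close>.
\<close>

definition vec_tensor :: "complex^'p \<Rightarrow> complex^'q \<Rightarrow> complex^('p \<times> 'q)"
  where "vec_tensor u v = (\<chi> pq. u $ fst pq * v $ snd pq)"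

definition tensor3 :: "complex^'x \<Rightarrow> complex^'y \<Rightarrow> complex^'z \<Rightarrow> complex^'z^'y^'x"
  where "tensor3 u v w = (\<chi> i j k. u $ i * v $ j * w $ k)"

definition triangle_tensor ::
    "complex^('m12::finite \<times> 'm02::finite)^('m01::finite \<times> 'm12)^('m01 \<times> 'm02)"
  where "triangle_tensor =
    (\<Sum>a\<in>UNIV. \<Sum>b\<in>UNIV. \<Sum>c\<in>UNIV.
       tensor3 (vec_tensor (axis a 1) (axis c 1))
               (vec_tensor (axis a 1) (axis b 1))
               (vec_tensor (axis b 1) (axis c 1)))"

text \<open>
  The action of \<open>X\<^sub>0 \<otimes> X\<^sub>1 \<otimes> X\<^sub>2\<close>, where \<open>X\<^sub>i \<in> Hom(W\<^sub>i, V\<^sub>i)\<close> is given by its matrix.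
\<close>

definition tensor3_map ::
    "complex^'p^'x \<Rightarrow> complex^'q^'y \<Rightarrow> complex^'r^'z \<Rightarrow> complex^'r^'q^'p \<Rightarrow> complex^'z^'y^'x"
  where "tensor3_map X0 X1 X2 T =
    (\<chi> i j k. \<Sum>p\<in>UNIV. \<Sum>q\<in>UNIV. \<Sum>r\<in>UNIV. X0 $ i $ p * X1 $ j $ q * X2 $ k $ r * T $ p $ q $ r)"

text \<open>
  The type arguments carry the bond dimensions \<open>m\<^sub>0\<^sub>1, m\<^sub>1\<^sub>2, m\<^sub>0\<^sub>2\<close> (as cardinalities); the physical
  dimensions are those of the result type.
\<close>

definition TNS_triangle ::
    "'m01::finite itself \<Rightarrow> 'm12::finite itself \<Rightarrow> 'm02::finite itself \<Rightarrow> (complex^'n2^'n1^'n0) set"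
  where "TNS_triangle _ _ _ = closure
    {tensor3_map X0 X1 X2 triangle_tensor | X0 X1 X2.
       X0 \<in> (UNIV :: (complex^('m01 \<times> 'm02)^'n0) set) \<and>
       X1 \<in> (UNIV :: (complex^('m01 \<times> 'm12)^'n1) set) \<and>
       X2 \<in> (UNIV :: (complex^('m12 \<times> 'm02)^'n2) set)}"

definition dual_space :: "(complex^'x \<Rightarrow> complex) set"
  where "dual_space = {\<phi>. Vector_Spaces.linear (*s) (*) \<phi>}"

definition flattening :: "complex^'z^'y^'x \<Rightarrow> (complex^'x \<Rightarrow> complex) \<Rightarrow> complex^'z^'y"
  where "flattening T \<phi> = (\<chi> j k. \<phi> (\<chi> i. T $ i $ j $ k))"

text \<open>
  Matrices as a complex vector space; note that \<open>*s\<close> on \<open>complex^'z^'y\<close> does not take complex scalars.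
\<close>

definition mat_scale :: "complex \<Rightarrow> complex^'z^'y \<Rightarrow> complex^'z^'y"
  where "mat_scale c M = (\<chi> j k. c * M $ j $ k)"

interpretation cmat: vector_space "mat_scale :: complex \<Rightarrow> complex^'z^'y \<Rightarrow> complex^'z^'y"
  by unfold_locales (simp_all add: mat_scale_def vec_eq_iff algebra_simps)

text \<open>The class of a nonzero matrix in projective space is the complex line it spans.\<close>

definition projectivization :: "(complex^'z^'y) set \<Rightarrow> (complex^'z^'y) set set"
  where "projectivization U = {cmat.span {M} | M. M \<in> U \<and> M \<noteq> 0}"

definition projective_line :: "(complex^'z^'y) set set \<Rightarrow> bool"
  where "projective_line L \<longleftrightarrow> (\<exists>U. cmat.subspace U \<and> cmat.dim U = 2 \<and> L = projectivization U)"

definition rank_variety :: "nat \<Rightarrow> (complex^'z^'y) set set"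
  where "rank_variety r = projectivization {M. rank M \<le> r}"

end

theory Submission
  imports Defs
begin

text \<open>
  Cut \<open>X\<^sub>1\<close> and \<open>X\<^sub>2\<close> into blocks \<open>Y\<^sub>a\<close> (\<open>n\<^sub>1 \<times> m\<^sub>1\<^sub>2\<close>) and \<open>Z\<^sub>c\<close> (\<open>m\<^sub>1\<^sub>2 \<times> n\<^sub>2\<close>). The slices of
  \<open>(X\<^sub>0 \<otimes> X\<^sub>1 \<otimes> X\<^sub>2) T(\<Delta>)\<close> are \<open>T\<^sub>i = \<Sum>\<^sub>a\<^sub>c A\<^sub>i(a, c) Y\<^sub>a Z\<^sub>c\<close>, with \<open>A\<^sub>i\<close> the \<open>2 \<times> 2\<close> matrix given by row \<open>i\<close> of
  \<open>X\<^sub>0\<close>. If \<open>A\<^sub>2 - x A\<^sub>1\<close> is singular, it is \<open>u v\<^sup>T\<close>, and \<open>T\<^sub>2 - x T\<^sub>1 = (\<Sum> u\<^sub>a Y\<^sub>a) (\<Sum> v\<^sub>c Z\<^sub>c)\<close> has rank at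
  most \<open>m\<^sub>1\<^sub>2\<close>; generically there are two such \<open>x\<close> and \<open>T\<^sub>1, T\<^sub>2\<close> are independent. Genericity is the
  nonvanishing of a polynomial in the entries of the \<open>X\<^sub>i\<close>, so moving along a segment towards a point
  where it does not vanish puts every tensor network state in the closure. Conversely, if the pencil is
  spanned by \<open>Y Z\<close> and \<open>Y' Z'\<close>, diagonal \<open>A\<^sub>i\<close> express \<open>T\<close> as a tensor network state.
\<close>

section \<open>Entries of the graph tensor and of its images\<close>

lemma sum_UNIV_prod:
  fixes f :: "'a::finite \<times> 'b::finite \<Rightarrow> 'c::comm_monoid_add"
  shows "(\<Sum>p\<in>UNIV. f p) = (\<Sum>a\<in>UNIV. \<Sum>b\<in>UNIV. f (a, b))"
  by (simp add: sum.cartesian_product)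

lemma triangle_tensor_nth:
  "triangle_tensor $ (a, c) $ (a', b) $ (b', c') = (if a = a' \<and> b = b' \<and> c = c' then 1 else 0)"
proof -
  \<comment> \<open>Each summand is rewritten with one equality guard per summation variable, so
    that \<open>sum.delta\<close> collapses the three sums.\<close>
  have "triangle_tensor $ (a, c) $ (a', b) $ (b', c') =
    (\<Sum>x\<in>UNIV. if x = a then \<Sum>y\<in>UNIV. if y = b then \<Sum>z\<in>UNIV. if z = c then
        (if a = a' \<and> b = b' \<and> c = c' then 1 else 0) else 0 else 0 else 0)"
    unfolding triangle_tensor_def sum_component
    by (intro sum.cong refl)
       (auto simp: tensor3_def vec_tensor_def axis_def simp del: sum.delta sum.delta'
         intro!: sum.cong sum.neutral)
  then show ?thesis by simp
qed

text \<open>The sum over \<open>b\<close> is entry \<open>(j, k)\<close> of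
  \<open>Y\<^sub>a Z\<^sub>c\<close>; later computations use this form in place of the sixfold
  sum.\<close>

lemma tensor3_map_triangle_tensor_nth:
  "tensor3_map X0 X1 X2 triangle_tensor $ i $ j $ k =
    (\<Sum>a\<in>UNIV. \<Sum>c\<in>UNIV. X0 $ i $ (a, c) * (\<Sum>b\<in>UNIV. X1 $ j $ (a, b) * X2 $ k $ (b, c)))"
proof -
  have "tensor3_map X0 X1 X2 triangle_tensor $ i $ j $ k =
    (\<Sum>a\<in>UNIV. \<Sum>c\<in>UNIV. \<Sum>a'\<in>UNIV. \<Sum>b\<in>UNIV. \<Sum>b'\<in>UNIV. \<Sum>c'\<in>UNIV.
      X0 $ i $ (a, c) * X1 $ j $ (a', b) * X2 $ k $ (b', c') *
      (if a = a' \<and> b = b' \<and> c = c' then 1 else 0))"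
    by (simp add: tensor3_map_def sum_UNIV_prod triangle_tensor_nth)
  also have "\<dots> = (\<Sum>a\<in>UNIV. \<Sum>c\<in>UNIV. \<Sum>a'\<in>UNIV. if a' = a then \<Sum>b\<in>UNIV. \<Sum>b'\<in>UNIV.
      if b' = b then \<Sum>c'\<in>UNIV. if c' = c then X0 $ i $ (a, c) * X1 $ j $ (a, b) * X2 $ k $ (b, c)
       else 0 else 0 else 0)"
    by (intro sum.cong refl)
       (auto simp del: sum.delta sum.delta' intro!: sum.cong sum.neutral)
  also have "\<dots> = (\<Sum>a\<in>UNIV. \<Sum>c\<in>UNIV. X0 $ i $ (a, c) * (\<Sum>b\<in>UNIV. X1 $ j $ (a, b) * X2 $ k $ (b, c)))"
    by (simp add: sum_distrib_left mult.assoc)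
  finally show ?thesis .
qed

section \<open>Rank and factorization of matrices\<close>

lemma rank_matrix_mult_le:
  fixes Y :: "'a::field^'m^'n" and Z :: "'a^'k^'m"
  shows "rank (Y ** Z) \<le> CARD('m)"
proof -
  have "rows (Y ** Z) \<subseteq> vec.span (rows Z)"
  proof
    fix r assume "r \<in> rows (Y ** Z)"
    then obtain i where "r = row i (Y ** Z)" by (auto simp: rows_def)
    then have "r = (\<Sum>b\<in>UNIV. Y $ i $ b *s row b Z)"
      by (simp add: row_def matrix_matrix_mult_def vec_eq_iff)
    moreover have "row b Z \<in> rows Z" for b by (auto simp: rows_def)
    ultimately show "r \<in> vec.span (rows Z)"
      by (simp add: vec.span_sum vec.span_scale vec.span_base)
  qed
  moreover have "rows Z = (\<lambda>b. row b Z) ` UNIV"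
    by (auto simp: rows_def)
  ultimately have "vec.dim (rows (Y ** Z)) \<le> card ((\<lambda>b. row b Z) ` UNIV)"
    by (intro vec.dim_le_card) auto
  also have "\<dots> \<le> CARD('m)"
    by (rule card_image_le) simp
  finally show ?thesis by (simp add: row_rank_def_gen)
qed

text \<open>A basis \<open>B\<close> of the row space has at most \<open>CARD('m)\<close> elements
  and so embeds into the index type \<open>'m\<close>; \<open>Z\<close> lists the basis, and
  \<open>Y\<close> holds the coordinates of the rows of \<open>M\<close>.\<close>

lemma rank_le_factorization:
  fixes M :: "'a::field^'k^'n"
  assumes "rank M \<le> CARD('m::finite)"
  obtains Y :: "'a^'m^'n" and Z :: "'a^'k^'m" where "M = Y ** Z"
proof -
  obtain B where B: "B \<subseteq> rows M" "vec.independent B" "rows M \<subseteq> vec.span B" "card B = vec.dim (rows M)"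
    using vec.basis_exists by blast
  have fin: "finite B"
    using B(2) by (rule vec.finiteI_independent)
  have "card B \<le> CARD('m)"
    using assms B(4) by (simp add: row_rank_def_gen)
  then obtain f :: "'a^'k \<Rightarrow> 'm" where f: "inj_on f B"
    using card_le_inj[OF fin, of "UNIV :: 'm set"] by auto
  have "\<exists>u. row i M = (\<Sum>b\<in>B. u b *s b)" for i
  proof -
    have "row i M \<in> vec.span B" using B(3) by (auto simp: rows_def)
    then show ?thesis by (auto simp: vec.span_finite[OF fin])
  qed
  then obtain u where u: "\<And>i. row i M = (\<Sum>b\<in>B. u i b *s b)" by metis
  define Y :: "'a^'m^'n" where "Y = (\<chi> i x. if x \<in> f ` B then u i (inv_into B f x) else 0)"
  define Z :: "'a^'k^'m" where "Z = (\<chi> x. inv_into B f x)"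
  have "M $ i $ k = (Y ** Z) $ i $ k" for i k
  proof -
    have "(Y ** Z) $ i $ k = (\<Sum>x\<in>f ` B. Y $ i $ x * Z $ x $ k)"
      unfolding matrix_matrix_mult_def
      by (simp, intro sum.mono_neutral_right) (auto simp: Y_def)
    also have "\<dots> = (\<Sum>b\<in>B. u i b * b $ k)"
      using f by (simp add: sum.reindex Y_def Z_def)
    also have "\<dots> = row i M $ k" by (simp add: u)
    finally show ?thesis by (simp add: row_def)
  qed
  then have "M = Y ** Z" by (simp add: vec_eq_iff)
  then show thesis by (rule that)
qed

text \<open>If \<open>a\<close> is nonzero, the second row is \<open>c / a\<close> times the first;
  otherwise \<open>b * c = 0\<close>, so the first row or the first column vanishes.\<close>

lemma outer_product_2x2:
  fixes a b c d :: "'a::field"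
  assumes "a * d = b * c"
  obtains u v :: "2 \<Rightarrow> 'a" where "a = u 1 * v 1" "b = u 1 * v 2" "c = u 2 * v 1" "d = u 2 * v 2"
proof -
  obtain u1 v1 v2 u2 where "a = u1 * v1" "b = u1 * v2" "c = u2 * v1" "d = u2 * v2"
  proof (cases "a = 0")
    case False
    with assms that[of a 1 "b / a" c] show thesis by (simp add: field_simps)
  next
    case True
    with assms have "b = 0 \<or> c = 0" by simp
    with True that[of 0 c d 1] that[of b 0 1 d] show thesis by auto
  qed
  then show thesis
    using that[of "\<lambda>i. if i = 1 then u1 else u2" "\<lambda>i. if i = 1 then v1 else v2"] by simp
qed

section \<open>The flattening image as a pencil of matrices\<close>

lemma flattening_image_dual_space:
  fixes T :: "complex^'z^'y^2"
  shows "flattening T ` dual_space = range (\<lambda>(s, t). mat_scale s (T $ 1) + mat_scale t (T $ 2))"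
proof (intro equalityI subsetI)
  fix M assume "M \<in> flattening T ` dual_space"
  then obtain \<phi> where lin: "Vector_Spaces.linear (*s) (*) \<phi>" and M: "M = flattening T \<phi>"
    by (auto simp: dual_space_def)
  interpret \<phi>: Vector_Spaces.linear "(*s)" "(*)" \<phi> by fact
  define s t where "s = \<phi> (axis 1 1)" and "t = \<phi> (axis 2 1)"
  \<comment> \<open>A functional on a two-dimensional space is determined by its values
    \<open>s\<close>, \<open>t\<close> on the basis vectors.\<close>
  have expand: "\<phi> v = s * v $ 1 + t * v $ 2" for v
  proof -
    have "v = v $ 1 *s axis 1 1 + v $ 2 *s axis 2 1"
      by (simp add: vec_eq_iff forall_2 axis_def)
    then have "\<phi> v = \<phi> (v $ 1 *s axis 1 1 + v $ 2 *s axis 2 1)" by simp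
    then show ?thesis by (simp only: \<phi>.add \<phi>.scale mult.commute s_def t_def)
  qed
  have "M = mat_scale s (T $ 1) + mat_scale t (T $ 2)"
    by (simp add: M flattening_def mat_scale_def vec_eq_iff expand)
  then show "M \<in> range (\<lambda>(s, t). mat_scale s (T $ 1) + mat_scale t (T $ 2))" by auto
next
  fix M assume "M \<in> range (\<lambda>(s, t). mat_scale s (T $ 1) + mat_scale t (T $ 2))"
  then obtain s t where M: "M = mat_scale s (T $ 1) + mat_scale t (T $ 2)" by auto
  have "(\<lambda>v. s * v $ 1 + t * v $ 2) \<in> dual_space"
    unfolding dual_space_def mem_Collect_eq
    by unfold_locales (simp_all add: algebra_simps)
  moreover have "M = flattening T (\<lambda>v. s * v $ 1 + t * v $ 2)"
    by (simp add: M flattening_def mat_scale_def vec_eq_iff)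
  ultimately show "M \<in> flattening T ` dual_space" by blast
qed

lemma range_pencil_eq_span:
  "range (\<lambda>(s, t). mat_scale s A + mat_scale t B) = cmat.span {A, B}"
proof (intro equalityI subsetI)
  fix M assume "M \<in> range (\<lambda>(s, t). mat_scale s A + mat_scale t B)"
  then obtain s t where "M = mat_scale s A + mat_scale t B" by auto
  then show "M \<in> cmat.span {A, B}"
    by (simp add: cmat.span_add cmat.span_scale cmat.span_base)
next
  fix M assume "M \<in> cmat.span {A, B}"
  then obtain s t where "M - mat_scale s A = mat_scale t B"
    by (auto simp: cmat.span_insert[of A "{B}"] cmat.span_singleton)
  then have "M = mat_scale s A + mat_scale t B" by (simp add: algebra_simps)
  then show "M \<in> range (\<lambda>(s, t). mat_scale s A + mat_scale t B)"
    by (intro range_eqI[of _ _ "(s, t)"]) simp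
qed

section \<open>Polynomial functions and limits along curves\<close>

lemma range_poly_const: "(\<lambda>t. c) \<in> range poly"
  by (rule range_eqI[of _ _ "[:c:]"]) auto

lemma range_poly_id: "(\<lambda>t. t) \<in> range (poly :: 'a::comm_ring_1 poly \<Rightarrow> _)"
  by (rule range_eqI[of _ _ "[:0, 1:]"]) auto

lemma range_poly_add:
  assumes "f \<in> range poly" "g \<in> range poly" shows "(\<lambda>t. f t + g t) \<in> range poly"
  using assms by (auto simp: fun_eq_iff simp flip: poly_add)

lemma range_poly_mult:
  assumes "f \<in> range poly" "g \<in> range poly" shows "(\<lambda>t. f t * g t) \<in> range poly"
  using assms by (auto simp: fun_eq_iff simp flip: poly_mult)

lemma range_poly_diff:
  fixes f :: "'a::comm_ring_1 \<Rightarrow> 'a"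
  assumes "f \<in> range poly" "g \<in> range poly" shows "(\<lambda>t. f t - g t) \<in> range poly"
  using assms by (auto simp: fun_eq_iff simp flip: poly_diff)

lemma range_poly_sum:
  assumes "\<And>i. i \<in> I \<Longrightarrow> f i \<in> range poly" shows "(\<lambda>t. \<Sum>i\<in>I. f i t) \<in> range poly"
  using assms
  by (induction I rule: infinite_finite_induct) (auto intro: range_poly_add range_poly_const)

text \<open>With these rules an expression is shown to be polynomial by following its structure,
  without exhibiting coefficients.\<close>

lemmas range_poly_intros =
  range_poly_const range_poly_id range_poly_add range_poly_mult range_poly_diff range_poly_sum

text \<open>A polynomial that is nonzero somewhere has finitely many roots, so \<open>F\<close> has
  no zero in a punctured neighbourhood of 0, even if \<open>F 0 = 0\<close>; there
  \<open>g t\<close> lies in \<open>S\<close> and tends to \<open>g 0\<close>.\<close>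

lemma curve_in_closure:
  fixes F :: "complex \<Rightarrow> complex"
  assumes "isCont g 0" "F \<in> range poly" "F t0 \<noteq> 0" and S: "\<And>t. F t \<noteq> 0 \<Longrightarrow> g t \<in> S"
  shows "g 0 \<in> closure S"
proof -
  obtain p where p: "F = poly p" using assms(2) by auto
  with assms(3) have "p \<noteq> 0" by auto
  then have "finite {t. poly p t = 0}" by (rule poly_roots_finite)
  then have "\<forall>\<^sub>F t in at 0. t \<notin> {t. poly p t = 0}"
    using islimpt_finite islimpt_iff_eventually by blast
  then have "\<forall>\<^sub>F t in at 0. g t \<in> closure S"
    by (rule eventually_mono) (use S p closure_subset in auto)
  then show ?thesis
    using assms(1) by (intro Lim_in_closed_set[of "closure S" g "at 0"]) (auto simp: isCont_def)
qed

text \<open>The parameter is complex, so that the entries are complex polynomial functions of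
  \<open>t\<close>.\<close>

definition segment :: "complex^'p^'x \<Rightarrow> complex^'p^'x \<Rightarrow> complex \<Rightarrow> complex^'p^'x"
  where "segment A B t = (\<chi> i j. (1 - t) * A $ i $ j + t * B $ i $ j)"

lemma segment_0_1 [simp]: "segment A B 0 = A" "segment A B 1 = B"
  by (simp_all add: segment_def vec_eq_iff)

lemma range_poly_segment: "(\<lambda>t. segment A B t $ i $ j) \<in> range poly"
  by (simp add: segment_def) (intro range_poly_intros)

section \<open>From two low-rank points on the line to a tensor network state\<close>

definition two_secant :: "nat \<Rightarrow> (complex^'z^'y^2) set"
  where "two_secant r = {T. projective_line (projectivization (flattening T ` dual_space)) \<and>
      (\<exists>p\<in>projectivization (flattening T ` dual_space) \<inter> rank_variety r.
       \<exists>q\<in>projectivization (flattening T ` dual_space) \<inter> rank_variety r. p \<noteq> q)}"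

lemma two_secant_obtain_pencil:
  fixes T :: "complex^'z^'y^2"
  assumes "T \<in> two_secant r"
  obtains M N \<alpha> \<beta> where "rank M \<le> r" "rank N \<le> r"
    "\<And>i. T $ i = mat_scale (\<alpha> i) M + mat_scale (\<beta> i) N"
proof -
  \<comment> \<open>The representative of \<open>p\<close> in the flattening image and the one of
    rank at most \<open>r\<close> may differ, but they span the same complex line, so the latter
    lies in the image too.\<close>
  have *: "\<exists>M s t. p = cmat.span {M} \<and> M \<noteq> 0 \<and> rank M \<le> r \<and>
      M = mat_scale s (T $ 1) + mat_scale t (T $ 2)"
    if "p \<in> projectivization (flattening T ` dual_space) \<inter> rank_variety r" for p
  proof -
    from that obtain M M' where M: "p = cmat.span {M}" "M \<noteq> 0" "rank M \<le> r"
      and M': "M' \<in> flattening T ` dual_space" "p = cmat.span {M'}"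
      by (auto simp: projectivization_def rank_variety_def)
    have "M \<in> cmat.span {M'}" using M(1) M'(2) cmat.span_base by blast
    also have "\<dots> \<subseteq> cmat.span {T $ 1, T $ 2}"
      using M'(1) unfolding flattening_image_dual_space range_pencil_eq_span
      by (intro cmat.span_minimal) auto
    finally show ?thesis using M unfolding range_pencil_eq_span[symmetric] by auto
  qed
  from assms obtain p q where "p \<noteq> q"
    "p \<in> projectivization (flattening T ` dual_space) \<inter> rank_variety r"
    "q \<in> projectivization (flattening T ` dual_space) \<inter> rank_variety r"
    unfolding two_secant_def by blast
  with *[of p] *[of q] obtain M N s t s' t' where
    ne: "cmat.span {M} \<noteq> cmat.span {N}" "M \<noteq> 0" "N \<noteq> 0" and rk: "rank M \<le> r" "rank N \<le> r"
    and M: "M = mat_scale s (T $ 1) + mat_scale t (T $ 2)"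
    and N: "N = mat_scale s' (T $ 1) + mat_scale t' (T $ 2)"
    by metis
  \<comment> \<open>\<open>D\<close> is the determinant of the matrix expressing \<open>M\<close>
    and \<open>N\<close> through the slices; \<open>DT\<close> is Cramer's rule.\<close>
  define D where "D = s * t' - s' * t"
  have DT: "mat_scale D (T $ 1) = mat_scale t' M - mat_scale t N"
    "mat_scale D (T $ 2) = mat_scale s N - mat_scale s' M"
    by (simp_all add: M N D_def mat_scale_def vec_eq_iff algebra_simps)
  \<comment> \<open>If \<open>D\<close> vanished, \<open>M\<close> and \<open>N\<close> would be
    proportional and define the same point.\<close>
  have "D \<noteq> 0"
  proof
    assume "D = 0"
    then have eq: "mat_scale t' M = mat_scale t N" "mat_scale s N = mat_scale s' M"
      using DT by simp_all
    have "s \<noteq> 0 \<or> t \<noteq> 0" using M ne(2) by auto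
    then obtain c where "N = mat_scale c M"
    proof
      assume "s \<noteq> 0"
      then have "N = mat_scale (s' / s) M"
        using arg_cong[OF eq(2), of "mat_scale (1 / s)"] by simp
      then show thesis by (rule that)
    next
      assume "t \<noteq> 0"
      then have "N = mat_scale (t' / t) M"
        using arg_cong[OF eq(1), of "mat_scale (1 / t)"] by simp
      then show thesis by (rule that)
    qed
    moreover from this ne(3) have "c \<noteq> 0" by auto
    ultimately have "M = mat_scale (1 / c) N" "N = mat_scale c M" by simp_all
    then have "M \<in> cmat.span {N}" "N \<in> cmat.span {M}"
      by (metis cmat.span_base cmat.span_scale singletonI)+
    then have "cmat.span {M} = cmat.span {N}"
      by (intro equalityI cmat.span_minimal) auto
    with ne(1) show False by simp
  qed
  then have "T $ 1 = mat_scale (t' / D) M + mat_scale (- t / D) N"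
    "T $ 2 = mat_scale (- s' / D) M + mat_scale (s / D) N"
    using arg_cong[OF DT(1), of "mat_scale (1 / D)"] arg_cong[OF DT(2), of "mat_scale (1 / D)"]
    by (simp_all add: cmat.scale_right_diff_distrib)
  then have "T $ i = mat_scale (if i = 1 then t' / D else - s' / D) M
      + mat_scale (if i = 1 then - t / D else s / D) N" for i
    using exhaust_2[of i] by auto
  then show thesis by (rule that[OF rk])
qed

lemma two_secant_obtain_tensor3_map:
  fixes T :: "complex^'n2^'n1^2"
  assumes "T \<in> two_secant CARD('m::finite)"
  obtains X0 :: "complex^(2 \<times> 2)^2" and X1 :: "complex^(2 \<times> 'm::finite)^'n1" and X2 :: "complex^('m::finite \<times> 2)^'n2"
  where "T = tensor3_map X0 X1 X2 triangle_tensor"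
proof -
  obtain M N \<alpha> \<beta> where rk: "rank M \<le> CARD('m)" "rank N \<le> CARD('m)"
    and T: "\<And>i. T $ i = mat_scale (\<alpha> i) M + mat_scale (\<beta> i) N"
    using two_secant_obtain_pencil[OF assms] by metis
  obtain Y :: "complex^'m^'n1" and Z :: "complex^'n2^'m" where M: "M = Y ** Z"
    using rank_le_factorization[OF rk(1)] .
  obtain Y' :: "complex^'m^'n1" and Z' :: "complex^'n2^'m" where N: "N = Y' ** Z'"
    using rank_le_factorization[OF rk(2)] .
  \<comment> \<open>The first blocks are \<open>Y\<close>, \<open>Z\<close> and the second ones
    \<open>Y'\<close>, \<open>Z'\<close>; the diagonal \<open>X0\<close> removes the cross products
    \<open>Y ** Z'\<close> and \<open>Y' ** Z\<close>.\<close>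
  define X0 :: "complex^(2 \<times> 2)^2"
    where "X0 = (\<chi> i p. if fst p = snd p then if fst p = 1 then \<alpha> i else \<beta> i else 0)"
  define X1 :: "complex^(2 \<times> 'm)^'n1"
    where "X1 = (\<chi> j p. if fst p = 1 then Y $ j $ snd p else Y' $ j $ snd p)"
  define X2 :: "complex^('m \<times> 2)^'n2"
    where "X2 = (\<chi> k p. if snd p = 1 then Z $ fst p $ k else Z' $ fst p $ k)"
  have "T = tensor3_map X0 X1 X2 triangle_tensor"
    by (simp add: vec_eq_iff tensor3_map_triangle_tensor_nth sum_2 T M N
        mat_scale_def matrix_matrix_mult_def X0_def X1_def X2_def)
  then show thesis by (rule that)
qed

section \<open>A criterion for two low-rank points on the line\<close>

lemma two_secantI:
  fixes T :: "complex^'z^'y^2"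
  assumes indep: "T $ 1 $ j $ k * T $ 2 $ j' $ k' \<noteq> T $ 1 $ j' $ k' * T $ 2 $ j $ k"
    and "x \<noteq> y"
    and rk: "rank (T $ 2 - mat_scale x (T $ 1)) \<le> r" "rank (T $ 2 - mat_scale y (T $ 1)) \<le> r"
  shows "T \<in> two_secant r"
proof -
  let ?U = "flattening T ` dual_space"
  let ?M = "\<lambda>x. T $ 2 - mat_scale x (T $ 1)"
  have U: "?U = cmat.span {T $ 1, T $ 2}"
    by (simp add: flattening_image_dual_space range_pencil_eq_span)
  \<comment> \<open>Eliminating between the equations at entries \<open>(j, k)\<close> and
    \<open>(j', k')\<close> multiplies \<open>s\<close> and \<open>t\<close> by the nonzero minor
    \<open>?D\<close>.\<close>
  have eq0: "s = 0 \<and> t = 0" if "mat_scale s (T $ 1) + mat_scale t (T $ 2) = 0" for s t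
  proof -
    from that have e: "s * T $ 1 $ a $ b + t * T $ 2 $ a $ b = 0" for a b
      by (simp add: mat_scale_def vec_eq_iff)
    let ?D = "T $ 1 $ j $ k * T $ 2 $ j' $ k' - T $ 1 $ j' $ k' * T $ 2 $ j $ k"
    have "s * ?D = 0" "t * ?D = 0"
      using e[of j k] e[of j' k'] by algebra+
    with indep show ?thesis by simp
  qed
  have nz: "T $ 1 \<noteq> 0" using eq0[of 1 0] by auto
  have "T $ 2 \<notin> cmat.span {T $ 1}"
  proof
    assume "T $ 2 \<in> cmat.span {T $ 1}"
    then obtain c where "T $ 2 = mat_scale c (T $ 1)" by (auto simp: cmat.span_singleton)
    then show False using eq0[of c "-1"] by simp
  qed
  then have "cmat.independent {T $ 2, T $ 1}" "T $ 1 \<noteq> T $ 2"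
    using nz cmat.span_base[of "T $ 1" "{T $ 1}"]
    by (auto simp: cmat.independent_insert)
  then have "cmat.dim ?U = 2"
    unfolding U by (simp add: cmat.dim_eq_card_independent insert_commute)
  then have line: "projective_line (projectivization ?U)"
    unfolding projective_line_def U by (metis cmat.subspace_span)
  have M: "cmat.span {?M x} \<in> projectivization ?U \<inter> rank_variety r"
    if "rank (?M x) \<le> r" for x
  proof -
    have "?M x \<in> ?U" unfolding U
      by (intro cmat.span_diff cmat.span_scale cmat.span_base) auto
    moreover have "?M x \<noteq> 0" using eq0[of "-x" 1] by auto
    ultimately show ?thesis using that by (auto simp: projectivization_def rank_variety_def)
  qed
  have "cmat.span {?M x} \<noteq> cmat.span {?M y}"
  proof
    assume "cmat.span {?M x} = cmat.span {?M y}"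
    then have "?M x \<in> cmat.span {?M y}" using cmat.span_base by blast
    then obtain c where "?M x = mat_scale c (?M y)" by (auto simp: cmat.span_singleton)
    \<comment> \<open>Independence of the slices forces \<open>c = 1\<close>, and then
      \<open>x = y\<close>.\<close>
    then have "mat_scale (c * y - x) (T $ 1) + mat_scale (1 - c) (T $ 2) = 0"
      by (simp add: algebra_simps)
    with eq0 \<open>x \<noteq> y\<close> show False by force
  qed
  with line M[OF rk(1)] M[OF rk(2)] show ?thesis unfolding two_secant_def by blast
qed

section \<open>Singular members of a pencil of \<open>2 \<times> 2\<close> matrices\<close>

lemma quadratic_distinct_roots:
  fixes a b c :: complex
  assumes "a \<noteq> 0" "b^2 - 4 * a * c \<noteq> 0"
  obtains x y where "x \<noteq> y" "a * x^2 - b * x + c = 0" "a * y^2 - b * y + c = 0"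
proof (rule that)
  define d where "d = csqrt (b^2 - 4 * a * c)"
  have d: "d^2 = b^2 - 4 * a * c" by (simp add: d_def)
  with assms have "d \<noteq> 0" by auto
  with assms(1) show "(b + d) / (2 * a) \<noteq> (b - d) / (2 * a)" by simp
  \<comment> \<open>Completing the square: the candidates are the points where
    \<open>2 * a * x - b\<close> equals \<open>d\<close> or \<open>- d\<close>.\<close>
  have "4 * a * (a * x^2 - b * x + c) = (2 * a * x - b)^2 - d^2" for x
    unfolding d by (simp add: power2_eq_square algebra_simps)
  from this[of "(b + d) / (2 * a)"] this[of "(b - d) / (2 * a)"] assms(1)
  show "a * ((b + d) / (2 * a))^2 - b * ((b + d) / (2 * a)) + c = 0"
    "a * ((b - d) / (2 * a))^2 - b * ((b - d) / (2 * a)) + c = 0"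
    by simp_all
qed

text \<open>
  With \<open>A\<^sub>i\<close> the \<open>2 \<times> 2\<close> matrix given by row \<open>i\<close> of \<open>X\<close>,
  \<open>det (A\<^sub>2 - x A\<^sub>1) = pencil_lead X * x\<^sup>2 - pencil_mid X * x + pencil_const X\<close>.
\<close>

definition pencil_lead :: "complex^(2 \<times> 2)^2 \<Rightarrow> complex"
  where "pencil_lead X = X $ 1 $ (1, 1) * X $ 1 $ (2, 2) - X $ 1 $ (1, 2) * X $ 1 $ (2, 1)"

definition pencil_mid :: "complex^(2 \<times> 2)^2 \<Rightarrow> complex"
  where "pencil_mid X = X $ 1 $ (1, 1) * X $ 2 $ (2, 2) + X $ 1 $ (2, 2) * X $ 2 $ (1, 1)
    - X $ 1 $ (1, 2) * X $ 2 $ (2, 1) - X $ 1 $ (2, 1) * X $ 2 $ (1, 2)"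

definition pencil_const :: "complex^(2 \<times> 2)^2 \<Rightarrow> complex"
  where "pencil_const X = X $ 2 $ (1, 1) * X $ 2 $ (2, 2) - X $ 2 $ (1, 2) * X $ 2 $ (2, 1)"

lemma rank_singular_pencil_member:
  fixes X0 :: "complex^(2 \<times> 2)^2" and X1 :: "complex^(2 \<times> 'm::finite)^'n1" and X2 :: "complex^('m::finite \<times> 2)^'n2"
  defines "T \<equiv> tensor3_map X0 X1 X2 triangle_tensor"
  assumes "pencil_lead X0 * x^2 - pencil_mid X0 * x + pencil_const X0 = 0"
  shows "rank (T $ 2 - mat_scale x (T $ 1)) \<le> CARD('m)"
proof -
  \<comment> \<open>\<open>N\<close> is \<open>A\<^sub>2 - x A\<^sub>1\<close>, whose determinant
    vanishes by hypothesis.\<close>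
  define N where "N a c = X0 $ 2 $ (a, c) - x * X0 $ 1 $ (a, c)" for a c
  have "N 1 1 * N 2 2 = N 1 2 * N 2 1"
    using assms(2) unfolding N_def pencil_lead_def pencil_mid_def pencil_const_def by algebra
  then obtain u v :: "2 \<Rightarrow> complex" where uv: "N 1 1 = u 1 * v 1" "N 1 2 = u 1 * v 2" "N 2 1 = u 2 * v 1" "N 2 2 = u 2 * v 2"
    by (rule outer_product_2x2)
  define Y :: "complex^'m^'n1" where "Y = (\<chi> j b. \<Sum>a\<in>UNIV. u a * X1 $ j $ (a, b))"
  define Z :: "complex^'n2^'m" where "Z = (\<chi> b k. \<Sum>c\<in>UNIV. v c * X2 $ k $ (b, c))"
  have "(T $ 2 - mat_scale x (T $ 1)) $ j $ k = (Y ** Z) $ j $ k" for j k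
  proof -
    \<comment> \<open>\<open>S a c\<close> is the entry of \<open>Y\<^sub>a Z\<^sub>c\<close>; since
      \<open>N a c = u a * v c\<close>, the weighted sum of these entries factors as a matrix
      product.\<close>
    define S where "S a c = (\<Sum>b\<in>UNIV. X1 $ j $ (a, b) * X2 $ k $ (b, c))" for a c
    have "(T $ 2 - mat_scale x (T $ 1)) $ j $ k
        = N 1 1 * S 1 1 + N 1 2 * S 1 2 + N 2 1 * S 2 1 + N 2 2 * S 2 2"
      by (simp add: T_def tensor3_map_triangle_tensor_nth mat_scale_def sum_2 N_def S_def algebra_simps)
    also have "\<dots> = (Y ** Z) $ j $ k"
      unfolding uv S_def Y_def Z_def
      by (simp add: matrix_matrix_mult_def sum_2 sum_distrib_left algebra_simps flip: sum.distrib)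
    finally show ?thesis .
  qed
  then have "T $ 2 - mat_scale x (T $ 1) = Y ** Z" by (simp add: vec_eq_iff)
  then show ?thesis by (simp add: rank_matrix_mult_le)
qed

section \<open>Perturbing a tensor network state to a generic one\<close>

lemma tensor3_map_in_closure_two_secant:
  fixes X0 :: "complex^(2 \<times> 2)^2" and X1 :: "complex^(2 \<times> 'm::finite)^'n1" and X2 :: "complex^('m::finite \<times> 2)^'n2"
  assumes "CARD('n1) * CARD('n2) \<ge> 2"
  shows "tensor3_map X0 X1 X2 triangle_tensor \<in> closure (two_secant CARD('m))"
proof -
  \<comment> \<open>Two distinct matrix positions are needed for a \<open>2 \<times> 2\<close> minor
    that tests independence of the slices.\<close>
  have "\<not> is_singleton (UNIV :: ('n1 \<times> 'n2) set)"
    using assms by (auto simp: is_singleton_altdef)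
  then obtain j k j' k' where ne: "(j :: 'n1, k :: 'n2) \<noteq> (j', k')"
    by (metis (full_types) UNIV_I empty_iff is_singletonI' surj_pair)
  \<comment> \<open>The image of \<open>(D0, D1, D2)\<close> has slices \<open>E\<^sub>j\<^sub>k + E\<^sub>j\<^sub>'\<^sub>k\<^sub>'\<close> and \<open>E\<^sub>j\<^sub>'\<^sub>k\<^sub>'\<close>; its \<open>2 \<times> 2\<close> pencil is
    \<open>diag (1, 1)\<close>, \<open>diag (0, 1)\<close>, so all the genericity conditions in \<open>F\<close> hold there.\<close>
  define D0 :: "complex^(2 \<times> 2)^2"
    where "D0 = (\<chi> i p. if fst p = snd p \<and> (i = 1 \<or> fst p = 2) then 1 else 0)"
  define D1 :: "complex^(2 \<times> 'm::finite)^'n1"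
    where "D1 = (\<chi> l p. if l = (if fst p = 1 then j else j') \<and> snd p = undefined then 1 else 0)"
  define D2 :: "complex^('m::finite \<times> 2)^'n2"
    where "D2 = (\<chi> l p. if l = (if snd p = 1 then k else k') \<and> fst p = undefined then 1 else 0)"
  define Y0 where "Y0 = segment X0 D0"
  define g where "g t = tensor3_map (Y0 t) (segment X1 D1 t) (segment X2 D2 t) triangle_tensor" for t
  \<comment> \<open>The factors of \<open>F\<close> ensure in turn that the determinant has degree
    two in \<open>x\<close>, that its roots are distinct, and that the slices are
    independent.\<close>
  define F where "F t = pencil_lead (Y0 t) *
      (pencil_mid (Y0 t) * pencil_mid (Y0 t) - 4 * pencil_lead (Y0 t) * pencil_const (Y0 t)) *
      (g t $ 1 $ j $ k * g t $ 2 $ j' $ k' - g t $ 1 $ j' $ k' * g t $ 2 $ j $ k)" for t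
  have g: "(\<lambda>t. g t $ a $ b $ c) \<in> range poly" for a b c
    unfolding g_def tensor3_map_triangle_tensor_nth Y0_def
    by (intro range_poly_intros range_poly_segment)
  have "F \<in> range poly"
    unfolding F_def pencil_lead_def pencil_mid_def pencil_const_def Y0_def
    by (intro range_poly_intros range_poly_segment g)
  moreover have "isCont g 0"
    unfolding isCont_def
  proof (intro vec_tendstoI)
    fix a b c
    obtain p where "(\<lambda>t. g t $ a $ b $ c) = poly p" using g[of a b c] by auto
    then show "((\<lambda>t. g t $ a $ b $ c) \<longlongrightarrow> g 0 $ a $ b $ c) (at 0)"
      by (metis isCont_def poly_isCont)
  qed
  moreover have "F 1 \<noteq> 0"
  proof -
    \<comment> \<open>At \<open>t = 1\<close> each block product is a single matrix unit:
      \<open>undefined\<close> serves as a fixed index of type \<open>'m\<close>, and only it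
      contributes to the sum.\<close>
    have sums: "(\<Sum>b\<in>UNIV. D1 $ l $ (a, b) * D2 $ l' $ (b, c)) =
      (if l = (if a = 1 then j else j') \<and> l' = (if c = 1 then k else k') then 1 else 0)" for l l' a c
    proof -
      have "D1 $ l $ (a, b) * D2 $ l' $ (b, c) = (if b = undefined then
        (if l = (if a = 1 then j else j') \<and> l' = (if c = 1 then k else k') then 1 else 0) else 0)" for b
        by (simp add: D1_def D2_def)
      then show ?thesis by simp
    qed
    have "pencil_lead D0 = 1" "pencil_mid D0 = 1" "pencil_const D0 = 0"
      by (simp_all add: pencil_lead_def pencil_mid_def pencil_const_def D0_def)
    moreover have "g 1 $ 1 $ l $ l' = (if (l, l') = (j, k) then 1 else 0) + (if (l, l') = (j', k') then 1 else 0)"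
      "g 1 $ 2 $ l $ l' = (if (l, l') = (j', k') then 1 else 0)" for l l'
      unfolding g_def Y0_def
      by (simp_all add: tensor3_map_triangle_tensor_nth sums sum_2) (simp_all add: D0_def)
    ultimately show ?thesis using ne by (auto simp: F_def Y0_def)
  qed
  moreover have "g t \<in> two_secant CARD('m)" if "F t \<noteq> 0" for t
  proof -
    have "pencil_lead (Y0 t) \<noteq> 0" "(pencil_mid (Y0 t))^2 - 4 * pencil_lead (Y0 t) * pencil_const (Y0 t) \<noteq> 0"
      using that by (auto simp: F_def power2_eq_square)
    then obtain x y where "x \<noteq> y"
      "pencil_lead (Y0 t) * x^2 - pencil_mid (Y0 t) * x + pencil_const (Y0 t) = 0"
      "pencil_lead (Y0 t) * y^2 - pencil_mid (Y0 t) * y + pencil_const (Y0 t) = 0"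
      by (rule quadratic_distinct_roots)
    moreover have "g t $ 1 $ j $ k * g t $ 2 $ j' $ k' \<noteq> g t $ 1 $ j' $ k' * g t $ 2 $ j $ k"
      using that by (auto simp: F_def)
    ultimately show ?thesis
      unfolding g_def by (intro two_secantI rank_singular_pencil_member)
  qed
  ultimately have "g 0 \<in> closure (two_secant CARD('m))"
    by (intro curve_in_closure[of g F 1])
  then show ?thesis by (simp add: g_def Y0_def)
qed

section \<open>The two inclusions\<close>

theorem theorem5p1:
  assumes "CARD('n1::finite) * CARD('n2::finite) \<ge> 2"
  shows "(TNS_triangle TYPE(2) TYPE('m12::finite) TYPE(2) :: (complex^'n2^'n1^2) set) =
    closure {T. projective_line (projectivization (flattening T ` dual_space)) \<and>
      (\<exists>p\<in>projectivization (flattening T ` dual_space) \<inter> rank_variety CARD('m12).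
       \<exists>q\<in>projectivization (flattening T ` dual_space) \<inter> rank_variety CARD('m12). p \<noteq> q)}"
proof -
  let ?S = "two_secant CARD('m12) :: (complex^'n2^'n1^2) set"
  have "TNS_triangle TYPE(2) TYPE('m12) TYPE(2) = closure ?S"
  proof
    \<comment> \<open>As \<open>closure ?S\<close> is closed, it suffices to treat the tensors
      before closure is taken.\<close>
    show "TNS_triangle TYPE(2) TYPE('m12) TYPE(2) \<subseteq> closure ?S"
      unfolding TNS_triangle_def
      by (intro closure_minimal) (auto intro: tensor3_map_in_closure_two_secant[OF assms])
    \<comment> \<open>Tensors in \<open>?S\<close> are themselves images of the graph tensor, not
      only limits of such images.\<close>
    show "closure ?S \<subseteq> TNS_triangle TYPE(2) TYPE('m12) TYPE(2)"
      unfolding TNS_triangle_def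
      by (intro closure_mono subsetI) (erule two_secant_obtain_tensor3_map, blast)
  qed
  then show ?thesis unfolding two_secant_def .
qed

end
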